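(* Let $n\ge 2$. There exists a constant $c_n$ depending only on $n$ such that for every weight $w\in A_1$ on $\mathbb{R}^n$, every $0<\alpha<1$, every Lipschitz function $f$ on $\mathbb{R}^n$ with compact support, and every $x\in\mathbb{R}^n$, $$|f(x)|\le c_n\,(1-\alpha)\,[w]_{A_1}\,T_{w,\alpha}(\mathcal{D}^\alpha f)(x).$$
   Context: A weight is a non-negative locally integrable function $w$ on $\mathbb{R}^n$, not identically zero; for a ball $B$ write $w(B)=\int_B w(x)\,dx$. The weight $w$ is in the class $A_1$ if there is a constant $C$ such that for every ball $B$, $\frac{1}{|B|}\int_B w(z)\,dz\le C\,w(x)$ for almost every $x\in B$; the least such $C$ is denoted $[w]_{A_1}$. $B(x,r)$ is the Euclidean ball with center $x$ and radius $r$. For $0<\alpha<n$, $$T_{w,\alpha}f(x)=\int_{\mathbb{R}^n}\frac{|x-y|^\alpha}{w(B(x,|x-y|))}\,f(y)\,w(y)\,dy$$ (for non-negative $f$ the value may be $+\infty$). The nonlinear fractional differential operator is, for $0<\alpha<1$, $$\mathcal{D}^\alpha f(x)=\int_{\mathbb{R}^n}\frac{|f(x)-f(y)|}{|x-y|^{n+\alpha}}\,dy.$$ *)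

theory Defs
  imports "HOL-Analysis.Analysis"
begin

definition locally_integrable :: "(real^'n \<Rightarrow> real) \<Rightarrow> bool" where
  "locally_integrable w \<longleftrightarrow> (\<forall>K. compact K \<longrightarrow> set_integrable lebesgue K w)"

text \<open>
  Weights are locally integrable functions, hence considered up to null sets: ``not identically
  zero'' means that the weight does not vanish almost everywhere.
\<close>

definition weight :: "(real^'n \<Rightarrow> real) \<Rightarrow> bool" where
  "weight w \<longleftrightarrow> (\<forall>x. 0 \<le> w x) \<and> locally_integrable w \<and> \<not> (AE x in lebesgue. w x = 0)"

definition weight_mass :: "(real^'n \<Rightarrow> real) \<Rightarrow> (real^'n) set \<Rightarrow> real" where
  "weight_mass w B = set_lebesgue_integral lebesgue B w"

definition A1_bound :: "(real^'n \<Rightarrow> real) \<Rightarrow> real \<Rightarrow> bool" where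
  "A1_bound w C \<longleftrightarrow>
     (\<forall>z r. 0 < r \<longrightarrow>
        (AE x in lebesgue. x \<in> ball z r \<longrightarrow>
           1 / measure lebesgue (ball z r) * weight_mass w (ball z r) \<le> C * w x))"

definition A1_class :: "(real^'n \<Rightarrow> real) set" where
  "A1_class = {w. weight w \<and> (\<exists>C. A1_bound w C)}"

text \<open>
  For a weight in \<open>A1_class\<close> the infimum is attained (a countable union of null sets is null),
  so this is the least admissible constant.
\<close>

definition A1_const :: "(real^'n \<Rightarrow> real) \<Rightarrow> real" where
  "A1_const w = Inf {C. A1_bound w C}"

text \<open>
  Both operators below take values in \<^typ>\<open>ennreal\<close>, so that the value \<open>+\<infinity>\<close> is
  possible. Their kernels are \<open>0 / 0 = 0\<close> at \<open>y = x\<close>, which is irrelevant for the integrals;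
  for weights in \<open>A1_class\<close> the mass of every nonempty ball is positive, so no other division
  by zero occurs.
\<close>

definition T_op :: "(real^'n \<Rightarrow> real) \<Rightarrow> real \<Rightarrow> (real^'n \<Rightarrow> ennreal) \<Rightarrow> real^'n \<Rightarrow> ennreal" where
  "T_op w \<alpha> g x =
     (\<integral>\<^sup>+ y. ennreal (norm (x - y) powr \<alpha> / weight_mass w (ball x (norm (x - y))))
              * g y * ennreal (w y) \<partial>lebesgue)"

definition frac_diff_op :: "real \<Rightarrow> (real^'n \<Rightarrow> real) \<Rightarrow> real^'n \<Rightarrow> ennreal" where
  "frac_diff_op \<alpha> f x =
     (\<integral>\<^sup>+ y. ennreal (\<bar>f x - f y\<bar> / norm (x - y) powr (real CARD('n) + \<alpha>)) \<partial>lebesgue)"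

end

theory Submission
  imports Defs
begin

text \<open>
Write \<open>n\<close> for the dimension and \<open>v\<close> for the volume of the unit ball. The weight enters only
through a pointwise comparison of kernels. If \<open>y\<close> is not exceptional for any of the countably many
balls about \<open>x\<close> with rational radius, then the \<open>A\<^sub>1\<close> condition on such balls slightly larger than
\<open>B(x, |x - y|)\<close> gives \<open>w(B(x, |x - y|)) \<le> v [w] |x - y|\<^sup>n w(y)\<close>, that is,
\<open>|x - y|\<^sup>-\<^sup>n \<le> v [w] w(y) / w(B(x, |x - y|))\<close>. This reduces the theorem to the unweighted estimate
\<open>|f(x)| \<le> c (1 - \<alpha>) \<integral> |x - y| powr (\<alpha> - n) D\<^sup>\<alpha> f(y) dy\<close>.

For the unweighted estimate take \<open>x = 0\<close>. The measure \<open>dy / |y|\<^sup>n\<close> is invariant under dilations, so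
the integral of \<open>f(y) - f(l y)\<close> against it is, as in Frullani's formula, the limit of the integrals of
\<open>f\<close> over the annuli \<open>e \<le> |y| < l e\<close> as \<open>e\<close> tends to \<open>0\<close>. The same argument for \<open>|f|\<close> gives
\<open>v (1 - 1/l) |f(0)| \<le> \<integral> |f(y) - f(l y)| / |y|\<^sup>n dy\<close> for every \<open>l > 1\<close>
(\<open>value_at_0_le_dilation_difference\<close>). Put \<open>l = 1 + h\<close> with \<open>h \<le> 1\<close> and insert a point \<open>z\<close> that is
averaged over the ball \<open>B(y, h |y|)\<close>: both \<open>f(y) - f(z)\<close> and \<open>f(l y) - f(z)\<close> are then differences at
relative distance at most \<open>2 h\<close>. As \<open>1 - 1/l\<close> is comparable to \<open>h\<close>, this gives
\<open>h powr (n + 1) |f(0)| \<le> c \<integral>\<integral> |f(y) - f(z)| / |y|\<^bsup>2n\<^esup> dz dy\<close>, integrated over \<open>|z - y| < 2 h |y|\<close>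
(\<open>value_at_0_le_local_oscillation\<close>).

This holds at every scale \<open>h\<close> in \<open>(0, 1)\<close> with one constant, and the factor \<open>1 - \<alpha>\<close> comes from using
all scales at once. Multiply by \<open>h powr (- n - 1 - \<alpha>)\<close> and integrate over \<open>h\<close>. The left side becomes
\<open>|f(0)| / (1 - \<alpha>)\<close>. On the right side, after exchanging the integrals, the scales
\<open>h > |z - y| / (2 |y|)\<close> contribute at most \<open>(2 |y| / |z - y|) powr (n + \<alpha>)\<close>, which turns the weight
\<open>|y|\<^bsup>-2n\<^esup>\<close> into \<open>|y| powr (\<alpha> - n)\<close> times the kernel of \<open>D\<^sup>\<alpha>\<close>
(\<open>value_at_0_le_fractional_potential\<close>).
\<close>

section \<open>Dilations and the value at the origin\<close>

lemma nn_integral_lborel_affine: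
  fixes g :: "'a::euclidean_space \<Rightarrow> ennreal"
  assumes [measurable]: "g \<in> borel_measurable borel" and "c \<noteq> 0"
  shows "(\<integral>\<^sup>+y. g y \<partial>lborel) = ennreal (\<bar>c\<bar> ^ DIM('a)) * (\<integral>\<^sup>+y. g (t + c *\<^sub>R y) \<partial>lborel)"
  by (subst lborel_affine[OF \<open>c \<noteq> 0\<close>, of t])
     (simp add: nn_integral_density nn_integral_distr nn_integral_cmult)

lemma nn_integral_norm_dilation:
  fixes g :: "'a::euclidean_space \<Rightarrow> ennreal"
  assumes [measurable]: "g \<in> borel_measurable borel" and c: "c > 0"
  shows "(\<integral>\<^sup>+y. g (c *\<^sub>R y) * ennreal (1 / norm y ^ DIM('a)) \<partial>lborel)
       = (\<integral>\<^sup>+y. g y * ennreal (1 / norm y ^ DIM('a)) \<partial>lborel)"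
proof -
  let ?d = "DIM('a)"
  have "(\<integral>\<^sup>+y. g y * ennreal (1 / norm y ^ ?d) \<partial>lborel)
      = ennreal (c ^ ?d) * (\<integral>\<^sup>+y. g (c *\<^sub>R y) * ennreal (1 / norm (c *\<^sub>R y) ^ ?d) \<partial>lborel)"
    using c by (subst nn_integral_lborel_affine[of _ c 0]) auto
  also have "\<dots> = (\<integral>\<^sup>+y. ennreal (c ^ ?d) * (g (c *\<^sub>R y) * ennreal (1 / norm (c *\<^sub>R y) ^ ?d)) \<partial>lborel)"
    by (rule nn_integral_cmult[symmetric]) measurable
  also have "\<dots> = (\<integral>\<^sup>+y. g (c *\<^sub>R y) * ennreal (1 / norm y ^ ?d) \<partial>lborel)"
  proof (rule nn_integral_cong)
    fix y :: 'a
    have "c ^ ?d * (1 / norm (c *\<^sub>R y) ^ ?d) = 1 / norm y ^ ?d"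
      using c by (simp add: power_mult_distrib)
    then have "ennreal (c ^ ?d) * ennreal (1 / norm (c *\<^sub>R y) ^ ?d) = ennreal (1 / norm y ^ ?d)"
      using c by (metis ennreal_mult' less_imp_le zero_le_power)
    then show "ennreal (c ^ ?d) * (g (c *\<^sub>R y) * ennreal (1 / norm (c *\<^sub>R y) ^ ?d))
        = g (c *\<^sub>R y) * ennreal (1 / norm y ^ ?d)"
      by (metis mult.left_commute)
  qed
  finally show ?thesis by simp
qed

text \<open>
Frullani's argument, cut off at radius \<open>e\<close>. Invariance of \<open>dy / |y|\<^sup>n\<close> identifies the integral of
\<open>|f(l y)|\<close> outside the ball of radius \<open>e\<close> with that of \<open>|f(y)|\<close> outside the ball of radius \<open>l e\<close>; the
annulus between the two balls is what remains of the difference.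
\<close>

lemma annulus_le_dilation_difference:
  fixes f :: "'a::euclidean_space \<Rightarrow> real"
  assumes cont: "continuous_on UNIV f" and bdd: "bounded {y. f y \<noteq> 0}"
    and l: "1 < l" and e: "0 < e"
  shows "(\<integral>\<^sup>+y. ennreal \<bar>f y\<bar> * indicator (ball (0::'a) (l * e) - ball 0 e) y * ennreal (1 / norm y ^ DIM('a)) \<partial>lborel)
    \<le> (\<integral>\<^sup>+y. ennreal \<bar>f y - f (l *\<^sub>R y)\<bar> * ennreal (1 / norm y ^ DIM('a)) \<partial>lborel)"
proof -
  let ?d = "DIM('a)"
  let ?k = "\<lambda>y::'a. ennreal (1 / norm y ^ ?d)"
  have [measurable]: "f \<in> borel_measurable borel"
    using cont by (rule borel_measurable_continuous_onI)
  have [measurable]: "ball (0::'a) r \<in> sets borel" for r by simp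
  define O1 where "O1 r = (\<integral>\<^sup>+y. ennreal \<bar>f y\<bar> * indicator (- ball 0 r) y * ?k y \<partial>lborel)" for r
  define D where "D = (\<integral>\<^sup>+y. ennreal \<bar>f y - f (l *\<^sub>R y)\<bar> * ?k y \<partial>lborel)"
  have le: "e \<le> l * e" using l e by simp
  \<comment> \<open>Finiteness of the outer integral is what permits cancelling it at the end.\<close>
  have fin: "O1 (l * e) < \<infinity>"
  proof -
    obtain R where R: "\<And>y. f y \<noteq> 0 \<Longrightarrow> norm y < R"
      using bdd unfolding bounded_pos_less by auto
    have "compact (f ` cball 0 R)"
      using cont by (intro compact_continuous_image) (auto intro: continuous_on_subset)
    then obtain M where M: "M > 0" "\<And>y. norm y \<le> R \<Longrightarrow> \<bar>f y\<bar> \<le> M"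
      by (fastforce dest!: compact_imp_bounded simp: bounded_pos)
    have "O1 (l * e) \<le> (\<integral>\<^sup>+y. ennreal (M * (1 / (l * e) ^ ?d)) * indicator (ball (0::'a) R) y \<partial>lborel)"
      unfolding O1_def
    proof (rule nn_integral_mono)
      fix y :: 'a
      show "ennreal \<bar>f y\<bar> * indicator (- ball 0 (l * e)) y * ?k y
          \<le> ennreal (M * (1 / (l * e) ^ ?d)) * indicator (ball 0 R) y"
      proof (cases "f y \<noteq> 0 \<and> l * e \<le> norm y")
        case True
        then have y: "norm y < R" "l * e \<le> norm y" using R by auto
        have "\<bar>f y\<bar> * (1 / norm y ^ ?d) \<le> M * (1 / (l * e) ^ ?d)"
          using M y l e less_le_trans[OF mult_pos_pos[of l e] y(2)]
          by (intro mult_mono divide_left_mono power_mono mult_pos_pos zero_less_power) auto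
        then show ?thesis using y by (simp add: ennreal_mult'[symmetric] ennreal_leI)
      next
        case False
        then show ?thesis by (auto simp: indicator_def)
      qed
    qed
    also have "\<dots> < \<infinity>"
      using emeasure_lborel_ball_finite[of "0::'a" R]
      by (simp add: nn_integral_cmult_indicator ennreal_mult_less_top)
    finally show ?thesis .
  qed
  have "(\<integral>\<^sup>+y. ennreal \<bar>f y\<bar> * indicator (ball (0::'a) (l * e) - ball 0 e) y * ?k y \<partial>lborel) + O1 (l * e) = O1 e"
    unfolding O1_def
    by (subst nn_integral_add[symmetric], measurable, rule nn_integral_cong)
       (use le in \<open>auto simp: indicator_def\<close>)
  also have "O1 e \<le> D + O1 (l * e)"
  proof -
    have "O1 (l * e) = (\<integral>\<^sup>+y. ennreal \<bar>f (l *\<^sub>R y)\<bar> * indicator (- ball 0 (l * e)) (l *\<^sub>R y) * ?k y \<partial>lborel)"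
      unfolding O1_def using l
      by (subst nn_integral_norm_dilation[symmetric, of _ l]) auto
    also have "D + \<dots> = (\<integral>\<^sup>+y. (ennreal \<bar>f y - f (l *\<^sub>R y)\<bar>
          + ennreal \<bar>f (l *\<^sub>R y)\<bar> * indicator (- ball 0 (l * e)) (l *\<^sub>R y)) * ?k y \<partial>lborel)"
      unfolding D_def by (subst nn_integral_add[symmetric]) (auto simp: distrib_right)
    also have "O1 e \<le> \<dots>"
      unfolding O1_def
    proof (intro nn_integral_mono mult_right_mono)
      fix y :: 'a
      show "ennreal \<bar>f y\<bar> * indicator (- ball 0 e) y \<le> ennreal \<bar>f y - f (l *\<^sub>R y)\<bar>
          + ennreal \<bar>f (l *\<^sub>R y)\<bar> * indicator (- ball 0 (l * e)) (l *\<^sub>R y)"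
        using l e by (auto simp: indicator_def ennreal_plus[symmetric] simp del: ennreal_plus
            intro!: ennreal_leI)
    qed simp
    finally show ?thesis .
  qed
  finally show ?thesis
    using fin unfolding D_def[symmetric] by (auto simp: add.commute ennreal_add_left_cancel_le)
qed

text \<open>
On a small annulus \<open>e \<le> |y| < l e\<close> the function \<open>|f|\<close> exceeds any given \<open>a < |f(0)|\<close>, and the annulus
has measure at least \<open>v (1 - l\<^sup>-\<^sup>n)\<close> for \<open>dy / |y|\<^sup>n\<close>, whatever its size.
\<close>

lemma value_at_0_le_dilation_difference:
  fixes f :: "'a::euclidean_space \<Rightarrow> real"
  assumes cont: "continuous_on UNIV f" and bdd: "bounded {y. f y \<noteq> 0}" and l: "1 < l"
  shows "ennreal (unit_ball_vol DIM('a) * (1 - 1 / l) * \<bar>f 0\<bar>)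
    \<le> (\<integral>\<^sup>+y. ennreal \<bar>f y - f (l *\<^sub>R y)\<bar> * ennreal (1 / norm y ^ DIM('a)) \<partial>lborel)"
    (is "_ \<le> ?D")
proof (cases "f 0 = 0")
  case True then show ?thesis by simp
next
  case False
  let ?d = "DIM('a)" and ?v = "unit_ball_vol DIM('a)"
  have v: "?v > 0" by simp
  have *: "ennreal (?v * (1 - 1 / l) * a) \<le> ?D" if a: "0 < a" "a < \<bar>f 0\<bar>" for a
  proof -
    have "isCont f 0" using cont by (simp add: continuous_on_eq_continuous_at)
    then have "\<forall>\<^sub>F y in nhds 0. a < \<bar>f y\<bar>"
      using a by (intro order_tendstoD(1)[of "\<lambda>y. \<bar>f y\<bar>" "\<bar>f 0\<bar>"] tendsto_rabs)
        (auto simp: isCont_def tendsto_at_iff_tendsto_nhds)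
    then obtain r where r: "r > 0" "\<And>y. norm y < r \<Longrightarrow> a < \<bar>f y\<bar>"
      unfolding eventually_nhds_metric by (auto simp: dist_norm)
    define e where "e = r / l"
    have e: "e > 0" "l * e = r" "e \<le> l * e" using r l by (auto simp: e_def field_simps)
    have pw: "1 - 1 / l \<le> 1 - 1 / l ^ ?d"
      using l by (auto intro!: divide_left_mono self_le_power)
    have "?v * (1 - 1 / l) * a \<le> ?v * (1 - 1 / l ^ ?d) * a"
      using pw a v by (intro mult_right_mono mult_left_mono) auto
    also have "\<dots> = a / (l * e) ^ ?d * (?v * (l * e) ^ ?d - ?v * e ^ ?d)"
      using e(1) l by (simp add: field_simps)
    finally have "ennreal (?v * (1 - 1 / l) * a)
        \<le> ennreal (a / (l * e) ^ ?d * (?v * (l * e) ^ ?d - ?v * e ^ ?d))"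
      by (rule ennreal_leI)
    also have "\<dots> = ennreal (a / (l * e) ^ ?d) * emeasure lborel (ball (0::'a) (l * e) - ball 0 e)"
    proof -
      have "emeasure lborel (ball (0::'a) (l * e) - ball 0 e) = ennreal (?v * (l * e) ^ ?d) - ennreal (?v * e ^ ?d)"
        using e by (subst emeasure_Diff) (auto simp: emeasure_ball intro!: subset_ball)
      also have "\<dots> = ennreal (?v * (l * e) ^ ?d - ?v * e ^ ?d)"
        using e by (subst ennreal_minus) auto
      finally have E: "emeasure lborel (ball (0::'a) (l * e) - ball 0 e) = ennreal (?v * (l * e) ^ ?d - ?v * e ^ ?d)" .
      show ?thesis unfolding E by (rule ennreal_mult') (use a e in auto)
    qed
    also have "\<dots> = (\<integral>\<^sup>+y. ennreal (a / (l * e) ^ ?d) * indicator (ball (0::'a) (l * e) - ball 0 e) y \<partial>lborel)"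
      by (simp add: nn_integral_cmult_indicator)
    also have "\<dots> \<le> (\<integral>\<^sup>+y. ennreal \<bar>f y\<bar> * indicator (ball (0::'a) (l * e) - ball 0 e) y * ennreal (1 / norm y ^ ?d) \<partial>lborel)"
    proof (rule nn_integral_mono)
      fix y :: 'a
      have "a / (l * e) ^ ?d \<le> \<bar>f y\<bar> * (1 / norm y ^ ?d)" if "norm y < l * e" "e \<le> norm y"
      proof -
        have "a * (1 / (l * e) ^ ?d) \<le> \<bar>f y\<bar> * (1 / norm y ^ ?d)"
          using that a r(2)[of y] e l by (intro mult_mono divide_left_mono power_mono zero_less_power mult_pos_pos) auto
        then show ?thesis by simp
      qed
      then show "ennreal (a / (l * e) ^ ?d) * indicator (ball (0::'a) (l * e) - ball 0 e) y
          \<le> ennreal \<bar>f y\<bar> * indicator (ball (0::'a) (l * e) - ball 0 e) y * ennreal (1 / norm y ^ ?d)"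
        by (auto simp: indicator_def ennreal_mult'[symmetric] intro!: ennreal_leI)
    qed
    also have "\<dots> \<le> ?D"
      by (rule annulus_le_dilation_difference[OF cont bdd l e(1)])
    finally show ?thesis .
  qed
  show ?thesis
  proof (rule tendsto_upperbound)
    show "((\<lambda>a. ennreal (?v * (1 - 1 / l) * a)) \<longlongrightarrow> ennreal (?v * (1 - 1 / l) * \<bar>f 0\<bar>)) (at_left \<bar>f 0\<bar>)"
      by (intro tendsto_intros)
    show "\<forall>\<^sub>F a in at_left \<bar>f 0\<bar>. ennreal (?v * (1 - 1 / l) * a) \<le> ?D"
      using False * by (intro eventually_at_leftI[of 0]) auto
  qed simp
qed

section \<open>Oscillation at a fixed relative scale\<close>

text \<open>
The domain of integration is the ball of radius \<open>2 h |y|\<close> about \<open>y\<close>, written as an inequality so that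
joint measurability in \<open>h\<close>, \<open>y\<close> and \<open>z\<close> is visible.
\<close>

definition local_oscillation :: "('a::euclidean_space \<Rightarrow> real) \<Rightarrow> real \<Rightarrow> 'a \<Rightarrow> ennreal" where
  "local_oscillation f h y =
     (\<integral>\<^sup>+z. ennreal \<bar>f y - f z\<bar> * indicator {z. norm (z - y) < 2 * h * norm y} z \<partial>lborel)"

lemma borel_measurable_local_oscillation [measurable]:
  fixes f :: "'a::euclidean_space \<Rightarrow> real"
  assumes [measurable]: "f \<in> borel_measurable borel"
  shows "(\<lambda>(h, y). local_oscillation f h y) \<in> borel_measurable (borel \<Otimes>\<^sub>M borel)"
    "local_oscillation f h \<in> borel_measurable borel"
  unfolding local_oscillation_def indicator_def mem_Collect_eq by measurable

text \<open>
Average the triangle inequality \<open>|f(y) - f(Y)| \<le> |f(y) - f(z)| + |f(Y) - f(z)|\<close>, where \<open>Y = (1 + h) y\<close>,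
over \<open>z\<close> in the ball of radius \<open>h |y|\<close> about \<open>y\<close>. Since \<open>|Y - y| = h |y|\<close>, this ball lies within the
two balls of the oscillations at \<open>y\<close> and at \<open>Y\<close>.
\<close>

lemma dilation_difference_le_local_oscillation:
  fixes f :: "'a::euclidean_space \<Rightarrow> real"
  assumes [measurable]: "f \<in> borel_measurable borel" and h: "0 < h" "h \<le> 1"
  shows "ennreal (unit_ball_vol DIM('a) * (h * norm y) ^ DIM('a)) * ennreal \<bar>f y - f ((1 + h) *\<^sub>R y)\<bar>
    \<le> local_oscillation f h y + local_oscillation f h ((1 + h) *\<^sub>R y)"
proof -
  let ?Y = "(1 + h) *\<^sub>R y"
  have "ennreal (unit_ball_vol DIM('a) * (h * norm y) ^ DIM('a)) * ennreal \<bar>f y - f ?Y\<bar>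
      = (\<integral>\<^sup>+z. ennreal \<bar>f y - f ?Y\<bar> * indicator (ball y (h * norm y)) z \<partial>lborel)"
    using h by (subst nn_integral_cmult_indicator) (auto simp: emeasure_ball mult.commute)
  also have "\<dots> \<le> (\<integral>\<^sup>+z. ennreal \<bar>f y - f z\<bar> * indicator {z. norm (z - y) < 2 * h * norm y} z
      + ennreal \<bar>f ?Y - f z\<bar> * indicator {z. norm (z - ?Y) < 2 * h * norm ?Y} z \<partial>lborel)"
  proof (rule nn_integral_mono)
    fix z :: 'a
    have "ennreal \<bar>f y - f ?Y\<bar> \<le> ennreal \<bar>f y - f z\<bar> + ennreal \<bar>f ?Y - f z\<bar>"
      by (auto simp: ennreal_plus[symmetric] simp del: ennreal_plus intro!: ennreal_leI)
    moreover have "norm (z - y) < 2 * h * norm y \<and> norm (z - ?Y) < 2 * h * norm ?Y"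
      if "norm (z - y) < h * norm y"
    proof -
      have "norm (z - ?Y) \<le> norm (z - y) + norm (y - ?Y)"
        using norm_triangle_ineq[of "z - y" "y - ?Y"] by simp
      also have "y - ?Y = - (h *\<^sub>R y)" by (simp add: algebra_simps)
      also have "norm (z - y) + norm (- (h *\<^sub>R y)) < 2 * h * norm y"
        using that h by simp
      also have "\<dots> \<le> 2 * h * norm ?Y"
      proof (rule mult_left_mono)
        have "norm ?Y = (1 + h) * norm y" using h by simp
        then show "norm y \<le> norm ?Y" using h by (simp add: distrib_right)
      qed (use h in simp)
      finally have "norm (z - ?Y) < 2 * h * norm ?Y" .
      moreover have "0 \<le> h * norm y" using h by simp
      ultimately show ?thesis using that by linarith
    qed
    ultimately show "ennreal \<bar>f y - f ?Y\<bar> * indicator (ball y (h * norm y)) z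
      \<le> ennreal \<bar>f y - f z\<bar> * indicator {z. norm (z - y) < 2 * h * norm y} z
      + ennreal \<bar>f ?Y - f z\<bar> * indicator {z. norm (z - ?Y) < 2 * h * norm ?Y} z"
      by (auto simp: indicator_def dist_norm norm_minus_commute)
  qed
  also have "\<dots> = local_oscillation f h y + local_oscillation f h ?Y"
    unfolding local_oscillation_def indicator_def mem_Collect_eq
    by (subst nn_integral_add[symmetric]) measurable
  finally show ?thesis .
qed

text \<open>
The oscillations at \<open>y\<close> and at \<open>(1 + h) y\<close> have, by dilation invariance, the same integral up to the
factor \<open>(1 + h)\<^sup>n \<le> 2\<^sup>n\<close>.
\<close>

lemma value_at_0_le_local_oscillation:
  fixes f :: "'a::euclidean_space \<Rightarrow> real"
  assumes cont: "continuous_on UNIV f" and bdd: "bounded {y. f y \<noteq> 0}" and h: "0 < h" "h \<le> 1"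
  shows "ennreal ((unit_ball_vol DIM('a))\<^sup>2 / 2 * h ^ (DIM('a) + 1) * \<bar>f 0\<bar>)
    \<le> ennreal (1 + 2 ^ DIM('a)) *
      (\<integral>\<^sup>+y. local_oscillation f h y * ennreal (1 / norm y ^ (2 * DIM('a))) \<partial>lborel)"
proof -
  let ?d = "DIM('a)" and ?v = "unit_ball_vol DIM('a)"
  let ?k = "\<lambda>y::'a. ennreal (1 / norm y ^ ?d)"
  let ?k2 = "\<lambda>y::'a. ennreal (1 / norm y ^ (2 * ?d))"
  let ?l = "1 + h"
  let ?S = "\<integral>\<^sup>+y. local_oscillation f h y * ?k2 y \<partial>lborel"
  have [measurable]: "f \<in> borel_measurable borel"
    using cont by (rule borel_measurable_continuous_onI)
  have v: "?v > 0" by simp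
  have kk: "?k y * ?k y = ?k2 y" for y
    by (simp add: ennreal_mult'[symmetric] power_add[symmetric] mult_2)
  \<comment> \<open>The gain of one power of \<open>h\<close> over the volume factor \<open>h\<^sup>n\<close>.\<close>
  have "h / 2 \<le> 1 - 1 / ?l" using h by (simp add: field_simps)
  then have "?v ^ 2 / 2 * h ^ (?d + 1) * \<bar>f 0\<bar> \<le> ?v * h ^ ?d * (?v * (1 - 1 / ?l) * \<bar>f 0\<bar>)"
    using h v mult_left_mono[of "h / 2" "1 - 1 / ?l" "?v^2 * h ^ ?d * \<bar>f 0\<bar>"]
    by (simp add: power2_eq_square mult_ac)
  then have "ennreal (?v\<^sup>2 / 2 * h ^ (?d + 1) * \<bar>f 0\<bar>)
      \<le> ennreal (?v * h ^ ?d) * ennreal (?v * (1 - 1 / ?l) * \<bar>f 0\<bar>)"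
    using h v by (subst ennreal_mult'[symmetric]) (auto intro!: ennreal_leI)
  also have "\<dots> \<le> ennreal (?v * h ^ ?d) * (\<integral>\<^sup>+y. ennreal \<bar>f y - f (?l *\<^sub>R y)\<bar> * ?k y \<partial>lborel)"
    using h by (intro mult_left_mono value_at_0_le_dilation_difference cont bdd) auto
  also have "\<dots> = (\<integral>\<^sup>+y. ennreal (?v * h ^ ?d) * (ennreal \<bar>f y - f (?l *\<^sub>R y)\<bar> * ?k y) \<partial>lborel)"
    by (rule nn_integral_cmult[symmetric]) measurable
  also have "\<dots> = (\<integral>\<^sup>+y. ennreal (?v * (h * norm y) ^ ?d) * ennreal \<bar>f y - f (?l *\<^sub>R y)\<bar> * ?k2 y \<partial>lborel)"
  proof (rule nn_integral_cong)
    fix y :: 'a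
    have "?v * h ^ ?d * (1 / norm y ^ ?d) = ?v * (h * norm y) ^ ?d * (1 / norm y ^ (2 * ?d))"
      by (cases "y = 0") (simp_all add: power_mult_distrib mult_2 power_add)
    then have "ennreal (?v * h ^ ?d) * ?k y = ennreal (?v * (h * norm y) ^ ?d) * ?k2 y"
      using h v by (subst (1 2) ennreal_mult'[symmetric]) auto
    then have "ennreal (?v * h ^ ?d) * ?k y * ennreal \<bar>f y - f (?l *\<^sub>R y)\<bar>
        = ennreal (?v * (h * norm y) ^ ?d) * ?k2 y * ennreal \<bar>f y - f (?l *\<^sub>R y)\<bar>"
      by (rule arg_cong)
    then show "ennreal (?v * h ^ ?d) * (ennreal \<bar>f y - f (?l *\<^sub>R y)\<bar> * ?k y)
        = ennreal (?v * (h * norm y) ^ ?d) * ennreal \<bar>f y - f (?l *\<^sub>R y)\<bar> * ?k2 y"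
      by (simp only: mult_ac)
  qed
  also have "\<dots> \<le> (\<integral>\<^sup>+y. (local_oscillation f h y + local_oscillation f h (?l *\<^sub>R y)) * ?k2 y \<partial>lborel)"
    using h by (intro nn_integral_mono mult_right_mono dilation_difference_le_local_oscillation) auto
  also have "\<dots> = ?S + (\<integral>\<^sup>+y. local_oscillation f h (?l *\<^sub>R y) * ?k2 y \<partial>lborel)"
    by (subst nn_integral_add[symmetric]) (auto simp: distrib_right)
  also have "(\<integral>\<^sup>+y. local_oscillation f h (?l *\<^sub>R y) * ?k2 y \<partial>lborel)
      = (\<integral>\<^sup>+y. ennreal (?l ^ ?d) * (local_oscillation f h (?l *\<^sub>R y) * ?k (?l *\<^sub>R y)) * ?k y \<partial>lborel)"
  proof (rule nn_integral_cong)
    fix y :: 'a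
    have "?l ^ ?d * (1 / norm (?l *\<^sub>R y) ^ ?d) = 1 / norm y ^ ?d"
      using h by (simp add: power_mult_distrib)
    then have "ennreal (?l ^ ?d) * ?k (?l *\<^sub>R y) = ?k y"
      using h by (subst ennreal_mult'[symmetric]) auto
    then have "local_oscillation f h (?l *\<^sub>R y) * (?k y * ?k y)
        = local_oscillation f h (?l *\<^sub>R y) * (ennreal (?l ^ ?d) * ?k (?l *\<^sub>R y) * ?k y)"
      by simp
    then show "local_oscillation f h (?l *\<^sub>R y) * ?k2 y
        = ennreal (?l ^ ?d) * (local_oscillation f h (?l *\<^sub>R y) * ?k (?l *\<^sub>R y)) * ?k y"
      unfolding kk[symmetric] by (simp only: mult_ac)
  qed
  also have "\<dots> = (\<integral>\<^sup>+y. ennreal (?l ^ ?d) * (local_oscillation f h y * ?k y) * ?k y \<partial>lborel)"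
    using h by (intro nn_integral_norm_dilation) auto
  also have "\<dots> = ennreal (?l ^ ?d) * ?S"
    by (subst nn_integral_cmult[symmetric]) (auto simp: kk[symmetric] mult.assoc)
  also have "?S + ennreal (?l ^ ?d) * ?S \<le> ?S + ennreal (2 ^ ?d) * ?S"
    using h by (intro add_left_mono mult_right_mono ennreal_leI power_mono) auto
  also have "\<dots> = ennreal (1 + 2 ^ ?d) * ?S"
    by (simp add: distrib_right)
  finally show ?thesis .
qed

section \<open>Integration over all scales\<close>

lemma nn_integral_powr_tail:
  fixes s b :: real
  assumes s: "0 < s" and b: "0 < b"
  shows "(\<integral>\<^sup>+h. ennreal (h powr (- b - 1)) * indicator {s..} h \<partial>lborel) = ennreal (s powr (- b) / b)"
proof -
  have "(\<integral>\<^sup>+h. ennreal (h powr (- b - 1)) * indicator {s..} h \<partial>lborel)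
      = ennreal (0 - (- (s powr (- b) / b)))"
  proof (rule nn_integral_FTC_atLeast[where F = "\<lambda>h. - (h powr (- b) / b)"])
    fix h assume "s \<le> h"
    then show "DERIV (\<lambda>h. - (h powr (- b) / b)) h :> h powr (- b - 1)"
      using s b by (auto intro!: derivative_eq_intros simp: field_simps)
  next
    have "((\<lambda>h. h powr (- b)) \<longlongrightarrow> 0) at_top"
      using b by (intro tendsto_neg_powr filterlim_ident) auto
    from tendsto_minus[OF tendsto_divide[OF this tendsto_const, of b]]
    show "((\<lambda>h. - (h powr (- b) / b)) \<longlongrightarrow> 0) at_top" using b by simp
  qed auto
  then show ?thesis by simp
qed

text \<open>
The source of the factor \<open>1 - \<alpha>\<close> in the theorem.
\<close>

lemma nn_integral_powr_01:
  fixes a :: real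
  assumes "a < 1"
  shows "(\<integral>\<^sup>+h. ennreal (h powr (- a)) * indicator {0<..<1} h \<partial>lborel) = ennreal (1 / (1 - a))"
proof -
  have "((\<lambda>h. h powr (- a)) has_integral (1 powr (- a + 1) / (- a + 1))) {0..1}"
    by (rule has_integral_powr_from_0) (use assms in auto)
  then have "((\<lambda>h. h powr (- a)) has_integral (1 / (1 - a))) {0..1}"
    by simp
  then have "((\<lambda>h. h powr (- a)) has_integral (1 / (1 - a))) {0<..<1}"
    by (subst has_integral_Icc_iff_Ioo[symmetric])
  then have "(\<integral>\<^sup>+h. ennreal (h powr (- a) * indicator {0<..<1} h) \<partial>lborel) = ennreal (1 / (1 - a))"
    by (intro nn_integral_has_integral_lborel) 
       (auto simp: has_integral_restrict_UNIV[symmetric, where s="{0<..<1}"] indicator_def of_bool_def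
           if_distrib[of "\<lambda>u. _ * u"] cong: if_cong)
  then show ?thesis
    by (simp add: ennreal_mult' ennreal_indicator[symmetric])
qed

text \<open>
For fixed \<open>y\<close> and \<open>z\<close> the admissible scales are those above \<open>s = |y - z| / (2 |y|)\<close>, and
\<open>s powr (- n - \<alpha>) |y|\<^bsup>-2n\<^esup>\<close> is a multiple of \<open>|y| powr (\<alpha> - n)\<close> times the kernel of \<open>D\<^sup>\<alpha>\<close>. The
constant does not depend on \<open>\<alpha>\<close> because \<open>1 \<le> n + \<alpha> \<le> n + 1\<close>.
\<close>

lemma nn_integral_scale_kernel:
  fixes y z :: "'a::euclidean_space" and \<alpha> :: real
  assumes \<alpha>: "0 < \<alpha>" "\<alpha> < 1" and y: "y \<noteq> 0" "z \<noteq> y"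
  shows "(\<integral>\<^sup>+h. ennreal (h powr (- (DIM('a) + \<alpha>) - 1)) * indicator {h. norm (z - y) < 2 * h * norm y} h \<partial>lborel)
      * ennreal (1 / norm y ^ (2 * DIM('a)))
    \<le> ennreal (2 ^ (DIM('a) + 1)) * (ennreal (norm y powr (\<alpha> - DIM('a))) * ennreal (1 / norm (y - z) powr (DIM('a) + \<alpha>)))"
proof -
  let ?d = "DIM('a)" and ?b = "DIM('a) + \<alpha>"
  define s where "s = norm (y - z) / (2 * norm y)"
  have s: "0 < s" using y by (simp add: s_def)
  have b: "1 \<le> ?b" using \<alpha> DIM_positive[where 'a='a] by linarith
  have "(\<integral>\<^sup>+h. ennreal (h powr (- ?b - 1)) * indicator {h. norm (z - y) < 2 * h * norm y} h \<partial>lborel)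
      \<le> (\<integral>\<^sup>+h. ennreal (h powr (- ?b - 1)) * indicator {s..} h \<partial>lborel)"
    using y by (intro nn_integral_mono mult_left_mono)
      (auto simp: indicator_def s_def norm_minus_commute field_simps)
  also have "\<dots> = ennreal (s powr (- ?b) / ?b)"
    using s b by (intro nn_integral_powr_tail) auto
  also have "\<dots> \<le> ennreal (s powr (- ?b))"
    using b frac_le[of "s powr (- ?b)" "s powr (- ?b)" 1 ?b] by (intro ennreal_leI) simp
  finally have "(\<integral>\<^sup>+h. ennreal (h powr (- ?b - 1)) * indicator {h. norm (z - y) < 2 * h * norm y} h \<partial>lborel)
      * ennreal (1 / norm y ^ (2 * ?d)) \<le> ennreal (s powr (- ?b)) * ennreal (1 / norm y ^ (2 * ?d))"
    by (rule mult_right_mono) simp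
  also have "\<dots> = ennreal (s powr (- ?b) * (1 / norm y ^ (2 * ?d)))"
    by (rule ennreal_mult'[symmetric]) simp
  also have "s powr (- ?b) * (1 / norm y ^ (2 * ?d))
      = 2 powr ?b * (norm y powr (\<alpha> - ?d) * (1 / norm (y - z) powr ?b))"
  proof -
    have s_eq: "s powr (- ?b) = 2 powr ?b * norm y powr ?b / norm (y - z) powr ?b"
      unfolding powr_minus s_def using y by (simp add: powr_divide powr_mult inverse_eq_divide)
    have "\<alpha> - ?d = ?b - real (2 * ?d)" by simp
    then have "norm y powr (\<alpha> - ?d) = norm y powr (?b - real (2 * ?d))"
      by (rule arg_cong)
    also have "\<dots> = norm y powr ?b * (1 / norm y ^ (2 * ?d))"
      using y by (subst powr_diff, subst powr_realpow) auto
    finally have y_eq: "norm y powr (\<alpha> - ?d) = norm y powr ?b * (1 / norm y ^ (2 * ?d))" .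
    show ?thesis unfolding s_eq y_eq by simp
  qed
  also have "ennreal \<dots> \<le> ennreal (2 ^ (?d + 1) * (norm y powr (\<alpha> - ?d) * (1 / norm (y - z) powr ?b)))"
  proof (intro ennreal_leI mult_right_mono)
    have "2 powr ?b \<le> 2 powr real (?d + 1)" using \<alpha> by (intro powr_mono) auto
    then show "2 powr ?b \<le> 2 ^ (?d + 1)" by (simp add: powr_realpow[symmetric] del: power_Suc)
  qed simp
  also have "\<dots> = ennreal (2 ^ (?d + 1)) * (ennreal (norm y powr (\<alpha> - ?d)) * ennreal (1 / norm (y - z) powr ?b))"
    by (simp only: ennreal_mult' powr_ge_zero zero_le_power zero_le_numeral)
  finally show ?thesis .
qed

text \<open>
The estimate at scale \<open>h\<close>, integrated over \<open>0 < h < 1\<close> with density \<open>h powr (- n - 1 - \<alpha>)\<close>. With its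
factor \<open>h\<^bsup>n+1\<^esup>\<close>, the left side is integrated against \<open>h powr (- \<alpha>)\<close>.
\<close>

lemma value_at_0_le_fractional_potential:
  fixes f :: "'a::euclidean_space \<Rightarrow> real" and \<alpha> :: real
  assumes cont: "continuous_on UNIV f" and bdd: "bounded {y. f y \<noteq> 0}" and \<alpha>: "0 < \<alpha>" "\<alpha> < 1"
  shows "ennreal ((unit_ball_vol DIM('a))\<^sup>2 / 2 * \<bar>f 0\<bar> * (1 / (1 - \<alpha>)))
    \<le> ennreal ((1 + 2 ^ DIM('a)) * 2 ^ (DIM('a) + 1)) *
      (\<integral>\<^sup>+y. ennreal (norm y powr (\<alpha> - DIM('a))) *
        (\<integral>\<^sup>+z. ennreal (\<bar>f y - f z\<bar> / norm (y - z) powr (DIM('a) + \<alpha>)) \<partial>lborel) \<partial>lborel)"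
proof -
  let ?d = "DIM('a)"
  let ?b = "DIM('a) + \<alpha>"
  let ?k = "\<lambda>y::'a. ennreal (1 / norm y ^ (2 * ?d))"
  let ?p = "\<lambda>h::real. ennreal (h powr (- ?b - 1))"
  let ?A = "(unit_ball_vol DIM('a))\<^sup>2 / 2 * \<bar>f 0\<bar>"
  let ?B = "ennreal (1 + 2 ^ DIM('a))"
  let ?C = "ennreal (2 ^ (DIM('a) + 1))"
  let ?I = "\<lambda>h (y::'a) z. indicator {z. norm (z - y) < 2 * h * norm y} z :: ennreal"
  let ?Q = "\<lambda>y z. ennreal (\<bar>f y - f z\<bar> / norm (y - z) powr ?b)"
  have [measurable]: "f \<in> borel_measurable borel"
    using cont by (rule borel_measurable_continuous_onI)
  have [measurable]: "(\<lambda>(h, y, z). ?I h y z) \<in> borel_measurable (borel \<Otimes>\<^sub>M borel \<Otimes>\<^sub>M borel)"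
    unfolding indicator_def mem_Collect_eq by measurable
  have "(\<integral>\<^sup>+h. (\<integral>\<^sup>+y. ?p h * local_oscillation f h y * ?k y \<partial>lborel) \<partial>lborel)
      = (\<integral>\<^sup>+y. (\<integral>\<^sup>+h. ?p h * local_oscillation f h y * ?k y \<partial>lborel) \<partial>(lborel :: 'a measure))"
    by (rule lborel_pair.Fubini') measurable
  also have "\<dots> = (\<integral>\<^sup>+y. (\<integral>\<^sup>+h. (\<integral>\<^sup>+z. ?p h * ?k y * ennreal \<bar>f y - f z\<bar> * ?I h y z \<partial>lborel) \<partial>lborel) \<partial>lborel)"
  proof (intro nn_integral_cong)
    fix y :: 'a and h :: real
    have "?p h * local_oscillation f h y * ?k y = (?p h * ?k y) * local_oscillation f h y"
      by (simp only: mult_ac)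
    also have "\<dots> = (\<integral>\<^sup>+z. (?p h * ?k y) * (ennreal \<bar>f y - f z\<bar> * ?I h y z) \<partial>lborel)"
      unfolding local_oscillation_def by (rule nn_integral_cmult[symmetric]) measurable
    finally show "?p h * local_oscillation f h y * ?k y = (\<integral>\<^sup>+z. ?p h * ?k y * ennreal \<bar>f y - f z\<bar> * ?I h y z \<partial>lborel)"
      by (simp only: mult.assoc)
  qed
  also have "\<dots> = (\<integral>\<^sup>+y. (\<integral>\<^sup>+z. (\<integral>\<^sup>+h. ?p h * ?k y * ennreal \<bar>f y - f z\<bar> * ?I h y z \<partial>lborel) \<partial>lborel) \<partial>lborel)"
    by (intro nn_integral_cong lborel_pair.Fubini') measurable
  also have "\<dots> \<le> (\<integral>\<^sup>+y. (\<integral>\<^sup>+z. ?C * (ennreal (norm y powr (\<alpha> - ?d)) * ?Q y z) \<partial>lborel) \<partial>lborel)"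
  proof (intro nn_integral_mono)
    fix y z :: 'a
    show "(\<integral>\<^sup>+h. ?p h * ?k y * ennreal \<bar>f y - f z\<bar> * ?I h y z \<partial>lborel)
        \<le> ?C * (ennreal (norm y powr (\<alpha> - ?d)) * ?Q y z)"
    proof (cases "y = 0 \<or> y = z")
      \<comment> \<open>For \<open>y = 0\<close> the factor \<open>1 / norm y ^ (2 * n)\<close> is \<open>0\<close> by the convention on division by zero.\<close>
      case True
      then show ?thesis by auto
    next
      case False
      have "(\<integral>\<^sup>+h. ?p h * ?k y * ennreal \<bar>f y - f z\<bar> * ?I h y z \<partial>lborel)
          = (\<integral>\<^sup>+h. (?k y * ennreal \<bar>f y - f z\<bar>) * (?p h * indicator {h. norm (z - y) < 2 * h * norm y} h) \<partial>lborel)"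
        by (intro nn_integral_cong) (auto simp: indicator_def mult_ac)
      also have "\<dots> = (?k y * ennreal \<bar>f y - f z\<bar>) *
          (\<integral>\<^sup>+h. ?p h * indicator {h. norm (z - y) < 2 * h * norm y} h \<partial>lborel)"
        by (intro nn_integral_cmult) measurable
      also have "\<dots> = ((\<integral>\<^sup>+h. ?p h * indicator {h. norm (z - y) < 2 * h * norm y} h \<partial>lborel) * ?k y)
          * ennreal \<bar>f y - f z\<bar>"
        by (simp only: mult_ac)
      also have "\<dots> \<le> (?C * (ennreal (norm y powr (\<alpha> - ?d)) * ennreal (1 / norm (y - z) powr ?b)))
          * ennreal \<bar>f y - f z\<bar>"
        using False \<alpha> by (intro mult_right_mono nn_integral_scale_kernel) auto
      also have "\<dots> = ?C * (ennreal (norm y powr (\<alpha> - ?d)) * (ennreal \<bar>f y - f z\<bar> * ennreal (1 / norm (y - z) powr ?b)))"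
        by (simp only: mult_ac)
      also have "ennreal \<bar>f y - f z\<bar> * ennreal (1 / norm (y - z) powr ?b) = ?Q y z"
        by (subst ennreal_mult'[symmetric]) auto
      finally show ?thesis .
    qed
  qed
  also have "\<dots> = ?C * (\<integral>\<^sup>+y. ennreal (norm y powr (\<alpha> - ?d)) * (\<integral>\<^sup>+z. ?Q y z \<partial>lborel) \<partial>lborel)"
    by (simp add: nn_integral_cmult)
  finally have scales: "(\<integral>\<^sup>+h. (\<integral>\<^sup>+y. ?p h * local_oscillation f h y * ?k y \<partial>lborel) \<partial>lborel)
      \<le> ?C * (\<integral>\<^sup>+y. ennreal (norm y powr (\<alpha> - ?d)) * (\<integral>\<^sup>+z. ?Q y z \<partial>lborel) \<partial>lborel)" .
  have "ennreal (?A * (1 / (1 - \<alpha>))) = ennreal ?A * (\<integral>\<^sup>+h. ennreal (h powr (- \<alpha>)) * indicator {0<..<1} h \<partial>lborel)"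
    using \<alpha> by (simp add: nn_integral_powr_01 ennreal_mult'[symmetric])
  also have "\<dots> = (\<integral>\<^sup>+h. ennreal ?A * (ennreal (h powr (- \<alpha>)) * indicator {0<..<1} h) \<partial>lborel)"
    by (rule nn_integral_cmult[symmetric]) measurable
  also have "\<dots> \<le> (\<integral>\<^sup>+h. ?B * (\<integral>\<^sup>+y. ?p h * local_oscillation f h y * ?k y \<partial>lborel) \<partial>lborel)"
  proof (rule nn_integral_mono)
    fix h :: real
    show "ennreal ?A * (ennreal (h powr (- \<alpha>)) * indicator {0<..<1} h)
        \<le> ?B * (\<integral>\<^sup>+y. ?p h * local_oscillation f h y * ?k y \<partial>lborel)"
    proof (cases "0 < h \<and> h < 1")
      case True
      have "h powr (- \<alpha>) = h ^ (?d + 1) * h powr (- ?b - 1)"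
        using True by (simp add: powr_realpow[symmetric] powr_add[symmetric] del: power_Suc)
      then have "ennreal ?A * (ennreal (h powr (- \<alpha>)) * indicator {0<..<1} h)
          = ennreal ((unit_ball_vol DIM('a))\<^sup>2 / 2 * h ^ (?d + 1) * \<bar>f 0\<bar>) * ?p h"
        using True by (simp add: ennreal_mult'[symmetric] ennreal_mult''[symmetric] mult_ac del: power_Suc)
      also have "\<dots> \<le> ?B * (\<integral>\<^sup>+y. local_oscillation f h y * ?k y \<partial>lborel) * ?p h"
        using True by (intro mult_right_mono value_at_0_le_local_oscillation cont bdd) auto
      also have "\<dots> = ?B * (?p h * (\<integral>\<^sup>+y. local_oscillation f h y * ?k y \<partial>lborel))"
        by (simp only: mult_ac)
      also have "?p h * (\<integral>\<^sup>+y. local_oscillation f h y * ?k y \<partial>lborel)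
          = (\<integral>\<^sup>+y. ?p h * (local_oscillation f h y * ?k y) \<partial>lborel)"
        by (rule nn_integral_cmult[symmetric]) measurable
      finally show ?thesis by (simp only: mult.assoc)
    qed auto
  qed
  also have "\<dots> = ?B * (\<integral>\<^sup>+h. (\<integral>\<^sup>+y. ?p h * local_oscillation f h y * ?k y \<partial>lborel) \<partial>lborel)"
    by (rule nn_integral_cmult) measurable
  also have "\<dots> \<le> ?B * (?C * (\<integral>\<^sup>+y. ennreal (norm y powr (\<alpha> - ?d)) * (\<integral>\<^sup>+z. ?Q y z \<partial>lborel) \<partial>lborel))"
    by (rule mult_left_mono[OF scales]) simp
  also have "\<dots> = ennreal ((1 + 2 ^ ?d) * 2 ^ (?d + 1)) * (\<integral>\<^sup>+y. ennreal (norm y powr (\<alpha> - ?d)) * (\<integral>\<^sup>+z. ?Q y z \<partial>lborel) \<partial>lborel)"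
    by (simp only: mult.assoc[symmetric]) (subst ennreal_mult'[symmetric], auto)
  finally show ?thesis .
qed

lemma value_le_fractional_potential:
  fixes f :: "'a::euclidean_space \<Rightarrow> real" and \<alpha> :: real
  assumes cont: "continuous_on UNIV f" and bdd: "bounded {y. f y \<noteq> 0}" and \<alpha>: "0 < \<alpha>" "\<alpha> < 1"
  shows "ennreal ((unit_ball_vol DIM('a))\<^sup>2 / 2 * \<bar>f x\<bar> * (1 / (1 - \<alpha>)))
    \<le> ennreal ((1 + 2 ^ DIM('a)) * 2 ^ (DIM('a) + 1)) *
      (\<integral>\<^sup>+y. ennreal (norm (x - y) powr (\<alpha> - DIM('a))) *
        (\<integral>\<^sup>+z. ennreal (\<bar>f y - f z\<bar> / norm (y - z) powr (DIM('a) + \<alpha>)) \<partial>lborel) \<partial>lborel)"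
proof -
  have [measurable]: "f \<in> borel_measurable borel"
    using cont by (rule borel_measurable_continuous_onI)
  have shift: "(\<integral>\<^sup>+y. g y \<partial>lborel) = (\<integral>\<^sup>+y. g (x + y) \<partial>lborel)"
    if "g \<in> borel_measurable borel" for g :: "'a \<Rightarrow> ennreal"
    using nn_integral_lborel_affine[OF that, of 1 x] by simp
  let ?Q = "\<lambda>y z. ennreal (\<bar>f y - f z\<bar> / norm (y - z) powr (DIM('a) + \<alpha>))"
  have "{y. f (x + y) \<noteq> 0} = (\<lambda>y. y - x) ` {y. f y \<noteq> 0}"
    by (force simp: image_iff algebra_simps intro: exI[of _ "x + _"])
  then have "bounded {y. f (x + y) \<noteq> 0}"
    using bdd by (simp add: bounded_translation_minus)
  moreover have "continuous_on UNIV (\<lambda>y. f (x + y))"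
    by (intro continuous_on_compose2[OF cont] continuous_intros) auto
  ultimately have "ennreal ((unit_ball_vol DIM('a))\<^sup>2 / 2 * \<bar>f (x + 0)\<bar> * (1 / (1 - \<alpha>)))
    \<le> ennreal ((1 + 2 ^ DIM('a)) * 2 ^ (DIM('a) + 1)) *
      (\<integral>\<^sup>+y. ennreal (norm y powr (\<alpha> - DIM('a))) *
        (\<integral>\<^sup>+z. ennreal (\<bar>f (x + y) - f (x + z)\<bar> / norm (y - z) powr (DIM('a) + \<alpha>)) \<partial>lborel) \<partial>lborel)"
    using \<alpha> by (intro value_at_0_le_fractional_potential)
  also have "(\<integral>\<^sup>+y. ennreal (norm y powr (\<alpha> - DIM('a))) *
        (\<integral>\<^sup>+z. ennreal (\<bar>f (x + y) - f (x + z)\<bar> / norm (y - z) powr (DIM('a) + \<alpha>)) \<partial>lborel) \<partial>lborel)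
      = (\<integral>\<^sup>+y. ennreal (norm (x - (x + y)) powr (\<alpha> - DIM('a))) * (\<integral>\<^sup>+z. ?Q (x + y) z \<partial>lborel) \<partial>lborel)"
  proof (rule nn_integral_cong)
    fix y :: 'a
    have "(\<integral>\<^sup>+z. ?Q (x + y) z \<partial>lborel) = (\<integral>\<^sup>+z. ?Q (x + y) (x + z) \<partial>lborel)"
      by (rule shift) measurable
    then show "ennreal (norm y powr (\<alpha> - DIM('a))) *
        (\<integral>\<^sup>+z. ennreal (\<bar>f (x + y) - f (x + z)\<bar> / norm (y - z) powr (DIM('a) + \<alpha>)) \<partial>lborel)
      = ennreal (norm (x - (x + y)) powr (\<alpha> - DIM('a))) * (\<integral>\<^sup>+z. ?Q (x + y) z \<partial>lborel)"
      by simp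
  qed
  also have "\<dots> = (\<integral>\<^sup>+y. ennreal (norm (x - y) powr (\<alpha> - DIM('a))) * (\<integral>\<^sup>+z. ?Q y z \<partial>lborel) \<partial>lborel)"
    by (rule shift[symmetric]) measurable
  finally show ?thesis by simp
qed

section \<open>Weights in the class \<open>A\<^sub>1\<close>\<close>

lemma weight_set_integrable_ball:
  fixes w :: "real^'n \<Rightarrow> real"
  assumes "weight w"
  shows "set_integrable lebesgue (ball x r) w"
proof -
  have "set_integrable lebesgue (cball x r) w"
    using assms by (auto simp: weight_def locally_integrable_def)
  then show ?thesis
    by (rule set_integrable_subset) (auto intro: subsetI)
qed

lemma weight_mass_nonneg: "weight w \<Longrightarrow> 0 \<le> weight_mass w A"
  unfolding weight_mass_def set_lebesgue_integral_def weight_def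
  by (intro integral_nonneg_AE AE_I2) (simp add: indicator_def)

lemma weight_mass_ball_mono:
  fixes w :: "real^'n \<Rightarrow> real"
  assumes w: "weight w" and "r \<le> R"
  shows "weight_mass w (ball x r) \<le> weight_mass w (ball x R)"
  unfolding weight_mass_def set_lebesgue_integral_def
proof (rule integral_mono)
  show "indicat_real (ball x r) y *\<^sub>R w y \<le> indicat_real (ball x R) y *\<^sub>R w y" for y
    using assms by (auto simp: indicator_def weight_def)
qed (use weight_set_integrable_ball[OF w] in \<open>auto simp: set_integrable_def\<close>)

lemma weight_mass_ball_eq_0:
  fixes w :: "real^'n \<Rightarrow> real"
  assumes w: "weight w" and "weight_mass w (ball x r) = 0"
  shows "AE y in lebesgue. y \<in> ball x r \<longrightarrow> w y = 0"
proof -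
  have "AE y in lebesgue. indicat_real (ball x r) y *\<^sub>R w y = 0"
    using assms weight_set_integrable_ball[OF w, of x r]
    unfolding weight_mass_def set_lebesgue_integral_def set_integrable_def
    by (subst (asm) integral_nonneg_eq_0_iff_AE) (auto simp: weight_def indicator_def)
  then show ?thesis by eventually_elim auto
qed

lemma not_AE_notin_ball:
  fixes x :: "'a::euclidean_space"
  assumes "0 < r"
  shows "\<not> (AE y in lebesgue. y \<notin> ball x r)"
proof -
  have "\<not> negligible (ball x r)"
    using assms by (intro open_not_negligible) auto
  then show ?thesis
    by (subst AE_iff_null_sets[symmetric]) (auto simp: negligible_iff_null_sets)
qed

text \<open>
A weight has positive mass on some large ball. The \<open>A\<^sub>1\<close> condition on that ball then bounds
\<open>C * w y\<close> from below by a positive number for almost every \<open>y\<close> in it, so neither can \<open>C\<close> be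
nonpositive nor can \<open>w\<close> vanish almost everywhere on a smaller ball.
\<close>

lemma A1_bound_imp_pos:
  fixes w :: "real^'n \<Rightarrow> real"
  assumes w: "weight w" and C: "A1_bound w C"
  shows "0 < C" and "0 < r \<Longrightarrow> 0 < weight_mass w (ball x r)"
proof -
  have "\<exists>k::nat. weight_mass w (ball x k) > 0" for x
  proof (rule ccontr)
    assume none: "\<not> ?thesis"
    have "weight_mass w (ball x (real k)) = 0" for k
    proof -
      have "\<not> 0 < weight_mass w (ball x (real k))"
        using none by blast
      then show ?thesis
        using weight_mass_nonneg[OF w, of "ball x k"] by linarith
    qed
    then have "AE y in lebesgue. \<forall>k::nat. y \<in> ball x k \<longrightarrow> w y = 0"
      using weight_mass_ball_eq_0[OF w] by (subst AE_all_countable) blast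
    then have "AE y in lebesgue. w y = 0"
      by eventually_elim (use reals_Archimedean2 in \<open>auto simp: mem_ball\<close>)
    then show False using w by (simp add: weight_def)
  qed
  then obtain k where k: "\<And>x. weight_mass w (ball x (real (k x))) > 0" by metis
  have *: "\<exists>a>0. AE y in lebesgue. y \<in> ball x R \<longrightarrow> a \<le> C * w y" if R: "real (k x) \<le> R" "R > 0" for x R
  proof (intro exI conjI)
    have "0 < weight_mass w (ball x R)"
      using k[of x] weight_mass_ball_mono[OF w R(1), of x] by linarith
    then show "0 < 1 / measure lebesgue (ball x R) * weight_mass w (ball x R)"
      using R by (simp add: measure_completion)
  qed (use C R in \<open>auto simp: A1_bound_def\<close>)
  show "0 < C"
  proof (rule ccontr)
    assume nC: "\<not> 0 < C"
    obtain a where "a > 0" and a: "AE y in lebesgue. y \<in> ball 0 (real (k 0) + 1) \<longrightarrow> a \<le> C * w y"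
      using *[of 0 "real (k 0) + 1"] by auto
    have "AE y in lebesgue. y \<notin> ball (0::real^'n) (real (k 0) + 1)"
      using a
    proof eventually_elim
      fix y :: "real^'n"
      have "C * w y \<le> 0"
        using nC w by (simp add: weight_def mult_nonpos_nonneg)
      then show "y \<notin> ball 0 (real (k 0) + 1)"
        if "y \<in> ball 0 (real (k 0) + 1) \<longrightarrow> a \<le> C * w y" using that \<open>a > 0\<close> by auto
    qed
    then show False using not_AE_notin_ball[of "real (k 0) + 1" "0::real^'n"] by simp
  qed
  show "0 < weight_mass w (ball x r)" if r: "0 < r"
  proof (rule ccontr)
    assume "\<not> ?thesis"
    then have "weight_mass w (ball x r) = 0"
      using weight_mass_nonneg[OF w, of "ball x r"] by linarith
    then have z: "AE y in lebesgue. y \<in> ball x r \<longrightarrow> w y = 0"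
      by (rule weight_mass_ball_eq_0[OF w])
    have "real (k x) \<le> max r (k x)" "0 < max r (k x)" using r by auto
    from *[OF this] obtain a
      where "a > 0" and a: "AE y in lebesgue. y \<in> ball x (max r (k x)) \<longrightarrow> a \<le> C * w y"
      by blast
    have "AE y in lebesgue. y \<notin> ball x r"
      using a z by eventually_elim (use \<open>a > 0\<close> in auto)
    then show False using not_AE_notin_ball[OF r] by blast
  qed
qed

text \<open>
Approximate the infimum by a sequence of admissible constants: the union of the countably many
exceptional sets is null, and outside it one may pass to the limit.
\<close>

lemma A1_const_attained:
  fixes w :: "real^'n \<Rightarrow> real"
  assumes "w \<in> A1_class"
  shows "A1_bound w (A1_const w)"
  unfolding A1_bound_def
proof (intro allI impI)
  fix z :: "real^'n" and r :: real assume r: "0 < r"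
  have w: "weight w" and ne: "{C. A1_bound w C} \<noteq> {}"
    using assms by (auto simp: A1_class_def)
  have "\<exists>C. A1_bound w C \<and> C < A1_const w + 1 / real (Suc m)" for m
    using cInf_lessD[OF ne, of "A1_const w + 1 / real (Suc m)"] by (auto simp: A1_const_def)
  then obtain C where C: "\<And>m. A1_bound w (C m)" "\<And>m. C m < A1_const w + 1 / real (Suc m)"
    by metis
  let ?a = "1 / measure lebesgue (ball z r) * weight_mass w (ball z r)"
  have "AE x in lebesgue. \<forall>m. x \<in> ball z r \<longrightarrow> ?a \<le> C m * w x"
    using C(1) r by (subst AE_all_countable) (auto simp: A1_bound_def)
  then show "AE x in lebesgue. x \<in> ball z r \<longrightarrow> ?a \<le> A1_const w * w x"
  proof eventually_elim
    fix x assume x: "\<forall>m. x \<in> ball z r \<longrightarrow> ?a \<le> C m * w x"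
    show "x \<in> ball z r \<longrightarrow> ?a \<le> A1_const w * w x"
    proof
      assume "x \<in> ball z r"
      have "?a \<le> (A1_const w + 1 / real (Suc m)) * w x" for m
      proof -
        have "?a \<le> C m * w x" using x \<open>x \<in> ball z r\<close> by blast
        also have "\<dots> \<le> (A1_const w + 1 / real (Suc m)) * w x"
          using C(2)[of m] w by (intro mult_right_mono) (auto simp: weight_def)
        finally show ?thesis .
      qed
      moreover have "(\<lambda>m. (A1_const w + 1 / real (Suc m)) * w x) \<longlonglongrightarrow> (A1_const w + 0) * w x"
        using LIMSEQ_Suc[OF lim_1_over_n[where 'a=real]] by (intro tendsto_intros)
      ultimately show "?a \<le> A1_const w * w x"
        using LIMSEQ_le_const[of _ "(A1_const w + 0) * w x" ?a] by simp
    qed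
  qed
qed

text \<open>
The point \<open>y\<close> lies on the boundary of the ball \<open>B(x, |x - y|)\<close>, which moreover varies with \<open>y\<close>, so
the \<open>A\<^sub>1\<close> condition does not apply to it directly. It is applied to the balls about \<open>x\<close> with
rational radius \<open>q > |x - y|\<close>, which share one null exceptional set, and then \<open>q\<close> decreases to
\<open>|x - y|\<close>.
\<close>

lemma A1_class_mass_le:
  fixes w :: "real^'n \<Rightarrow> real" and x :: "real^'n"
  assumes wA: "w \<in> A1_class"
  shows "AE y in lebesgue. weight_mass w (ball x (norm (x - y)))
    \<le> unit_ball_vol CARD('n) * A1_const w * w y * norm (x - y) ^ CARD('n)"
proof -
  let ?v = "unit_ball_vol CARD('n)"
  have w: "weight w" using wA by (simp add: A1_class_def)
  have C0: "0 < A1_const w" by (rule A1_bound_imp_pos(1)[OF w A1_const_attained[OF wA]])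
  have vol: "measure lebesgue (ball x q) = ?v * q ^ CARD('n)" if "0 < q" for q
    using that content_ball[of q x] by (simp add: measure_completion)
  have "AE y in lebesgue. \<forall>q::rat. 0 < q \<longrightarrow> y \<in> ball x (of_rat q) \<longrightarrow>
      1 / measure lebesgue (ball x (of_rat q)) * weight_mass w (ball x (of_rat q)) \<le> A1_const w * w y"
    unfolding AE_all_countable AE_impI
    using A1_const_attained[OF wA] by (auto simp: A1_bound_def intro!: AE_impI)
  then show ?thesis
  proof eventually_elim
    fix y assume y: "\<forall>q::rat. 0 < q \<longrightarrow> y \<in> ball x (of_rat q) \<longrightarrow>
      1 / measure lebesgue (ball x (of_rat q)) * weight_mass w (ball x (of_rat q)) \<le> A1_const w * w y"
    let ?R = "norm (x - y)" and ?K = "?v * A1_const w * w y"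
    have K: "0 \<le> ?K" using C0 w by (simp add: weight_def)
    have "weight_mass w (ball x ?R) \<le> ?K * t ^ CARD('n)" if t: "?R < t" for t
    proof -
      obtain q :: rat where q: "?R < of_rat q" "of_rat q < t"
        using of_rat_dense[OF t] by blast
      have q0: "0 < real_of_rat q" using q norm_ge_zero[of "x - y"] by linarith
      have "weight_mass w (ball x ?R) \<le> weight_mass w (ball x (of_rat q))"
        using q by (intro weight_mass_ball_mono w) auto
      also have "\<dots> \<le> ?K * of_rat q ^ CARD('n)"
        using y[rule_format, of q] q q0 unfolding vol[OF q0] by (simp add: dist_norm field_simps)
      also have "\<dots> \<le> ?K * t ^ CARD('n)"
        using K q q0 by (intro mult_left_mono power_mono) auto
      finally show ?thesis .
    qed
    then have "\<forall>\<^sub>F t in at_right ?R. weight_mass w (ball x ?R) \<le> ?K * t ^ CARD('n)"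
      by (simp add: eventually_at_right_less eventually_mono[OF eventually_at_right_less])
    moreover have "((\<lambda>t. ?K * t ^ CARD('n)) \<longlongrightarrow> ?K * ?R ^ CARD('n)) (at_right ?R)"
      by (intro tendsto_intros)
    ultimately show "weight_mass w (ball x ?R) \<le> ?K * ?R ^ CARD('n)"
      by (intro tendsto_lowerbound[of "\<lambda>t. ?K * t ^ CARD('n)"]) auto
  qed
qed

text \<open>
The previous bound says that the kernel of \<open>T_op\<close>, multiplied by \<open>w y\<close>, dominates the Riesz
kernel up to the constant \<open>v [w]\<close>.
\<close>

lemma riesz_potential_le_T_op:
  fixes w :: "real^'n \<Rightarrow> real" and x :: "real^'n" and \<alpha> :: real
  assumes wA: "w \<in> A1_class" and [measurable]: "g \<in> borel_measurable borel"
  shows "(\<integral>\<^sup>+y. ennreal (norm (x - y) powr (\<alpha> - CARD('n))) * g y \<partial>lborel)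
    \<le> ennreal (unit_ball_vol CARD('n) * A1_const w) * T_op w \<alpha> g x"
proof -
  let ?K = "unit_ball_vol CARD('n) * A1_const w"
  let ?s = "\<lambda>y. ennreal (norm (x - y) powr (\<alpha> - CARD('n))) * g y"
  have w: "weight w" using wA by (simp add: A1_class_def)
  note pos = A1_bound_imp_pos[OF w A1_const_attained[OF wA]]
  have K: "0 < ?K" using pos(1) by simp
  \<comment> \<open>The constant is put on the side of the Borel function, so that it can be taken out of the integral.\<close>
  have "ennreal (1 / ?K) * (\<integral>\<^sup>+y. ?s y \<partial>lborel) = (\<integral>\<^sup>+y. ennreal (1 / ?K) * ?s y \<partial>lborel)"
    by (rule nn_integral_cmult[symmetric]) measurable
  also have "\<dots> = (\<integral>\<^sup>+y. ennreal (1 / ?K) * ?s y \<partial>lebesgue)"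
    by (rule nn_integral_completion[symmetric])
  also have "\<dots> \<le> T_op w \<alpha> g x"
    unfolding T_op_def
  proof (rule nn_integral_mono_AE)
    show "AE y in lebesgue. ennreal (1 / ?K) * ?s y
      \<le> ennreal (norm (x - y) powr \<alpha> / weight_mass w (ball x (norm (x - y)))) * g y * ennreal (w y)"
      using A1_class_mass_le[OF wA, of x]
    proof eventually_elim
      fix y
      let ?R = "norm (x - y)"
      let ?m = "weight_mass w (ball x ?R)"
      assume le: "?m \<le> ?K * w y * ?R ^ CARD('n)"
      have "1 / ?K * ?R powr (\<alpha> - CARD('n)) \<le> ?R powr \<alpha> / ?m * w y"
      proof (cases "x = y")
        case False
        then have R: "0 < ?R" by simp
        have m: "0 < ?m" by (rule pos(2)[OF R])
        have "1 / ?K * ?R powr (\<alpha> - CARD('n)) = ?R powr \<alpha> * (1 / (?K * ?R ^ CARD('n)))"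
          using R by (simp add: powr_diff powr_realpow)
        also have "\<dots> \<le> ?R powr \<alpha> * (w y / ?m)"
        proof (rule mult_left_mono)
          have "1 / Q \<le> u / m" if "m \<le> u * Q" "0 < m" "0 < Q" for Q m u :: real
            using that by (simp add: field_simps)
          moreover have "?m \<le> w y * (?K * ?R ^ CARD('n))" using le by (simp only: mult_ac)
          moreover have "0 < ?K * ?R ^ CARD('n)" using K R by simp
          ultimately show "1 / (?K * ?R ^ CARD('n)) \<le> w y / ?m" using m by blast
        qed simp
        finally show ?thesis by simp
      qed simp
      then have "ennreal (1 / ?K) * ennreal (?R powr (\<alpha> - CARD('n))) \<le> ennreal (?R powr \<alpha> / ?m) * ennreal (w y)"
        using K w by (subst (1 2) ennreal_mult''[symmetric]) (auto simp: weight_def intro!: ennreal_leI)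
      then have "ennreal (1 / ?K) * ennreal (?R powr (\<alpha> - CARD('n))) * g y \<le> ennreal (?R powr \<alpha> / ?m) * ennreal (w y) * g y"
        by (rule mult_right_mono) simp
      then show "ennreal (1 / ?K) * ?s y \<le> ennreal (?R powr \<alpha> / ?m) * g y * ennreal (w y)"
        by (simp only: mult_ac)
    qed
  qed
  finally have "ennreal ?K * (ennreal (1 / ?K) * (\<integral>\<^sup>+y. ?s y \<partial>lborel)) \<le> ennreal ?K * T_op w \<alpha> g x"
    by (rule mult_left_mono) simp
  moreover have "ennreal ?K * ennreal (1 / ?K) = 1"
    using K by (subst ennreal_mult'[symmetric]) auto
  ultimately show ?thesis
    by (simp only: mult.assoc[symmetric] mult_1)
qed

section \<open>The weighted representation inequality\<close>

theorem theorem2p8: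
  assumes "CARD('n::finite) \<ge> 2"
  shows "\<exists>c::real. 0 < c \<and>
    (\<forall>(w :: real^'n \<Rightarrow> real) (\<alpha>::real) (f :: real^'n \<Rightarrow> real) (x :: real^'n).
       w \<in> A1_class \<longrightarrow> 0 < \<alpha> \<longrightarrow> \<alpha> < 1 \<longrightarrow>
       (\<exists>L. L-lipschitz_on UNIV f) \<longrightarrow> compact (closure {y. f y \<noteq> 0}) \<longrightarrow>
       ennreal \<bar>f x\<bar> \<le>
         ennreal (c * (1 - \<alpha>) * A1_const w) * T_op w \<alpha> (frac_diff_op \<alpha> f) x)"
proof -
  let ?v = "unit_ball_vol CARD('n)" and ?B = "(1 + 2 ^ CARD('n)) * 2 ^ (CARD('n) + 1) :: real"
  have v: "0 < ?v" by simp
  then have v0: "?v \<noteq> 0" by linarith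
  have B: "0 < ?B" by (intro mult_pos_pos add_pos_nonneg) auto
  show ?thesis
  proof (intro exI[of _ "2 * ?B / ?v"] conjI allI impI)
    show "0 < 2 * ?B / ?v" using v B by simp
  next
    fix w :: "real^'n \<Rightarrow> real" and \<alpha> :: real and f :: "real^'n \<Rightarrow> real" and x :: "real^'n"
    assume wA: "w \<in> A1_class" and \<alpha>: "0 < \<alpha>" "\<alpha> < 1"
      and lip: "\<exists>L. L-lipschitz_on UNIV f" and supp: "compact (closure {y. f y \<noteq> 0})"
    have cont: "continuous_on UNIV f" using lip lipschitz_on_continuous_on by blast
    then have [measurable]: "f \<in> borel_measurable borel"
      by (rule borel_measurable_continuous_onI)
    have bdd: "bounded {y. f y \<noteq> 0}"
      using supp by (meson bounded_subset closure_subset compact_imp_bounded)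
    have C0: "0 < A1_const w"
      using A1_bound_imp_pos(1)[OF _ A1_const_attained[OF wA]] wA by (simp add: A1_class_def)
    have Df: "frac_diff_op \<alpha> f = (\<lambda>y. \<integral>\<^sup>+z. ennreal (\<bar>f y - f z\<bar> / norm (y - z) powr (CARD('n) + \<alpha>)) \<partial>lborel)"
      by (simp add: frac_diff_op_def nn_integral_completion fun_eq_iff)
    have meas: "frac_diff_op \<alpha> f \<in> borel_measurable borel"
      unfolding Df by measurable
    let ?T = "T_op w \<alpha> (frac_diff_op \<alpha> f) x"
    let ?q = "2 * (1 - \<alpha>) / ?v\<^sup>2"
    have "ennreal \<bar>f x\<bar> = ennreal ?q * ennreal (?v\<^sup>2 / 2 * \<bar>f x\<bar> * (1 / (1 - \<alpha>)))"
      using \<alpha> v0 by (subst ennreal_mult'[symmetric]) auto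
    also have "\<dots> \<le> ennreal ?q * (ennreal ?B *
        (\<integral>\<^sup>+y. ennreal (norm (x - y) powr (\<alpha> - CARD('n))) * frac_diff_op \<alpha> f y \<partial>lborel))"
      using value_le_fractional_potential[OF cont bdd \<alpha>, of x] by (intro mult_left_mono) (simp_all add: Df)
    also have "\<dots> \<le> ennreal ?q * (ennreal ?B * (ennreal (?v * A1_const w) * ?T))"
      by (intro mult_left_mono riesz_potential_le_T_op wA meas) auto
    also have "\<dots> = ennreal (?q * (?B * (?v * A1_const w))) * ?T"
      using v B C0 \<alpha> by (subst (1 2) ennreal_mult') (auto simp: mult.assoc)
    also have "?q * (?B * (?v * A1_const w)) = 2 * ?B / ?v * (1 - \<alpha>) * A1_const w"
      using v by (simp add: power2_eq_square)
    finally show "ennreal \<bar>f x\<bar> \<le> ennreal (2 * ?B / ?v * (1 - \<alpha>) * A1_const w) * ?T" .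
  qed
qed

end
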